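(* Let $D\subset\mathbb{R}^3$ be a domain such that for every isometry $A$ of $\mathbb{R}^3$ the semitube domain $S_{A(D)}\subset\mathbb{C}^2$ is pseudoconvex. Then $D$ is convex.
   Context: Identify $\mathbb{R}^3$ with $\mathbb{C}\times\mathbb{R}$. For a set $B\subset\mathbb{R}^3$, the semitube set with base $B$ is $S_B:=\{(z_1,z_2)\in\mathbb{C}^2:(z_1,\operatorname{Re} z_2)\in B\}$, i.e. $S_B=B\times\mathbb{R}$ (the last factor being $\operatorname{Im} z_2$). When $B$ is a domain, $S_B$ is called a semitube domain. *)

theory Defs
  imports "HOL-Analysis.Analysis"
begin

text \<open>C^2 is modelled as complex \<times> complex; R^3 = C \<times> R as complex \<times> real
  (the product metric on pairs is the Euclidean one).\<close>

definition cline :: "complex \<times> complex \<Rightarrow> complex \<times> complex \<Rightarrow> complex \<Rightarrow> complex \<times> complex" where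
  "cline a v \<zeta> = (fst a + \<zeta> * fst v, snd a + \<zeta> * snd v)"

text \<open>Plurisubharmonicity of a continuous real-valued function on an open set of C^2:
  sub-mean-value property on every closed analytic disc contained in a complex line.\<close>
definition plurisubharmonic_on :: "(complex \<times> complex) set \<Rightarrow> (complex \<times> complex \<Rightarrow> real) \<Rightarrow> bool" where
  "plurisubharmonic_on \<Omega> \<phi> \<longleftrightarrow>
     (\<forall>a v. (\<forall>\<zeta>. cmod \<zeta> \<le> 1 \<longrightarrow> cline a v \<zeta> \<in> \<Omega>) \<longrightarrow>
        \<phi> a \<le> integral {0..2*pi} (\<lambda>t. \<phi> (cline a v (cis t))) / (2*pi))"

definition pseudoconvex :: "(complex \<times> complex) set \<Rightarrow> bool" where
  "pseudoconvex \<Omega> \<longleftrightarrow> open \<Omega> \<and>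
     (\<exists>\<phi>. continuous_on \<Omega> \<phi> \<and> plurisubharmonic_on \<Omega> \<phi> \<and>
          (\<forall>c::real. compact {z \<in> \<Omega>. \<phi> z \<le> c}))"

definition semitube :: "(complex \<times> real) set \<Rightarrow> (complex \<times> complex) set" where
  "semitube B = {(z1, z2). (z1, Re z2) \<in> B}"

definition isometry_R3 :: "(complex \<times> real \<Rightarrow> complex \<times> real) \<Rightarrow> bool" where
  "isometry_R3 A \<longleftrightarrow> (\<forall>x y. dist (A x) (A y) = dist x y)"

end

theory Submission
  imports Defs
begin

text \<open>If D is not convex, some right triangle has its hypotenuse and one leg in D but not the other
  leg. Rotate the missing leg onto the u-axis, with x + i y as the complex coordinate, so that the
  triangle lies in the half plane x \<le> 0, y = 0. Among the points of the complement
  of D in a thin box around the triangle, one minimises x + C y^2 - a u^2; for C large it is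
  interior to the box, and for a small the quadric through it has a negative Levi form. So near this
  point the semitube contains discs P = const < 0, with P a quadratic holomorphic polynomial,
  that accumulate at the point while their boundaries stay in a compact set. A plurisubharmonic
  exhaustion function would be bounded on the discs, a contradiction. Since plurisubharmonicity is
  only assumed as a mean value property on complex lines, the maximum principle on these curved discs
  comes from maximising \<open>\<phi> - N |P - const|^2 + |z2|^2\<close> over a thickened disc.\<close>

section \<open>Circle averages and the maximum principle\<close>

lemma has_integral_Re_cis_multiple:
  fixes m :: complex and n :: nat
  assumes "n > 0"
  shows "((\<lambda>t. Re (m * cis (real n * t))) has_integral 0) {0..2*pi}"
proof -
  let ?F = "\<lambda>t. (Re m * sin (real n * t) + Im m * cos (real n * t)) / real n"
  have "((\<lambda>t. Re (m * cis (real n * t))) has_integral (?F (2*pi) - ?F 0)) {0..2*pi}"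
  proof (rule fundamental_theorem_of_calculus)
    fix t :: real
    have "(?F has_field_derivative Re (m * cis (real n * t))) (at t within {0..2*pi})"
      using assms by (auto intro!: derivative_eq_intros simp: field_simps)
    then show "(?F has_vector_derivative Re (m * cis (real n * t))) (at t within {0..2*pi})"
      by (simp add: has_real_derivative_iff_has_vector_derivative)
  qed simp
  moreover have "sin (real n * (2*pi)) = 0" "cos (real n * (2*pi)) = 1"
    using sin_int_2pin[of "int n"] cos_int_2pin[of "int n"]
    by (simp_all add: mult_ac)
  ultimately show ?thesis by simp
qed

lemma cmod_add_power2:
  "(cmod (x + y))\<^sup>2 = (cmod x)\<^sup>2 + (cmod y)\<^sup>2 + 2 * Re (cnj x * y)"
  unfolding cmod_power2 by (simp add: power2_eq_square algebra_simps)

text \<open>The cross term is a nonconstant harmonic on the circle and averages out, so only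
  \<open>(cmod k)\<^sup>2\<close> survives.\<close>

lemma has_integral_norm_square_cis:
  fixes c k :: complex and n :: nat
  assumes "n > 0"
  shows "((\<lambda>t. (cmod (c + k * cis (real n * t)))\<^sup>2 - (cmod c)\<^sup>2) has_integral 2*pi * (cmod k)\<^sup>2) {0..2*pi}"
proof -
  have "((\<lambda>t. (cmod k)\<^sup>2 + 2 * Re (cnj c * k * cis (real n * t)))
      has_integral (2*pi * (cmod k)\<^sup>2 + 2 * 0)) {0..2*pi}"
    by (intro has_integral_add has_integral_mult_right has_integral_Re_cis_multiple assms)
      (use has_integral_const_real[of "(cmod k)\<^sup>2" 0 "2*pi"] in simp)
  then show ?thesis
    by (simp add: cmod_add_power2 norm_mult mult.assoc)
qed

lemma plurisubharmonic_le_majorant_mean: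
  assumes psh: "plurisubharmonic_on \<Omega> \<phi>" and cont: "continuous_on \<Omega> \<phi>"
    and disc: "\<And>\<zeta>. cmod \<zeta> \<le> 1 \<Longrightarrow> cline p v \<zeta> \<in> \<Omega>"
    and le: "\<And>t. \<phi> (cline p v (cis t)) \<le> g t"
    and int: "(g has_integral I) {0..2*pi}"
  shows "\<phi> p \<le> I / (2*pi)"
proof -
  have "continuous_on {0..2*pi} (\<lambda>t. \<phi> (cline p v (cis t)))"
    by (rule continuous_on_compose2[OF cont])
      (auto simp: cline_def intro!: continuous_intros disc[unfolded cline_def])
  then have "(\<lambda>t. \<phi> (cline p v (cis t))) integrable_on {0..2*pi}"
    by (rule integrable_continuous_real)
  then have "integral {0..2*pi} (\<lambda>t. \<phi> (cline p v (cis t))) \<le> I"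
    using int le by (intro has_integral_le[OF integrable_integral int]) auto
  moreover have "\<phi> p \<le> integral {0..2*pi} (\<lambda>t. \<phi> (cline p v (cis t))) / (2*pi)"
    using psh disc unfolding plurisubharmonic_on_def by blast
  ultimately show ?thesis
    by (smt (verit) divide_right_mono pi_gt_zero)
qed

lemma eventually_at_right_isCont_less:
  fixes f :: "real \<Rightarrow> real"
  assumes "isCont f x" and "f x < c"
  shows "\<forall>\<^sub>F y in at_right x. f y < c"
  using assms order_tendstoD(2) by (metis continuous_within filterlim_at_split isCont_def)

text \<open>The Levi form of the subtracted function is negative along the kernel of dh, whereas a
  smooth function touching a plurisubharmonic one from above has a nonnegative Levi form.\<close>

lemma plurisubharmonic_no_interior_max:
  fixes h :: "complex \<times> complex \<Rightarrow> complex" and N :: real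
  defines "\<psi> \<equiv> \<lambda>z. N * (cmod (h z))\<^sup>2 - (cmod (snd z))\<^sup>2"
  assumes psh: "plurisubharmonic_on \<Omega> \<phi>" and cont: "continuous_on \<Omega> \<phi>"
    and U: "open U" "U \<subseteq> \<Omega>" "p \<in> U"
    and max: "\<And>z. z \<in> U \<Longrightarrow> \<phi> z - \<psi> z \<le> \<phi> p - \<psi> p"
    and h: "\<And>z. h z = k + b1 * fst z + b2 * snd z + c1 * (fst z)\<^sup>2 + c2 * (snd z)\<^sup>2"
    and nz: "b1 + 2 * c1 * fst p \<noteq> 0"
  shows False
proof -
  \<comment> \<open>\<open>(v1, v2)\<close> spans the kernel of dh at \<open>p\<close>, so along
    this direction \<open>h\<close> has no linear term, only a quadratic one with coefficient
    \<open>K\<close>.\<close>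
  define v1 v2 where "v1 = - (b2 + 2 * c2 * snd p)" and "v2 = b1 + 2 * c1 * fst p"
  define K where "K = c1 * v1\<^sup>2 + c2 * v2\<^sup>2"
  have v2: "cmod v2 > 0" using nz by (simp add: v2_def)
  obtain e where e: "e > 0" "ball p e \<subseteq> U"
    using U openE by blast
  have "\<forall>\<^sub>F r in at_right 0. r * norm (v1, v2) < e"
    using e by (intro eventually_at_right_isCont_less) auto
  \<comment> \<open>The mean of \<open>\<psi>\<close> on the circle of radius \<open>r\<close> gains
    \<open>N r^4 |K|^2\<close> from the first term, of fourth order, and loses
    \<open>r^2 |v2|^2\<close> from the second; for small \<open>r\<close> the loss wins.\<close>
  moreover have "\<forall>\<^sub>F r in at_right 0. N * r\<^sup>2 * (cmod K)\<^sup>2 < (cmod v2)\<^sup>2"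
    using v2 by (intro eventually_at_right_isCont_less) auto
  moreover have "\<forall>\<^sub>F r in at_right (0::real). r > 0"
    by (simp add: eventually_at_right_less)
  ultimately have "\<forall>\<^sub>F r in at_right (0::real). r > 0 \<and> r * norm (v1, v2) < e \<and>
      N * r\<^sup>2 * (cmod K)\<^sup>2 < (cmod v2)\<^sup>2"
    by eventually_elim auto
  then obtain r where r: "r > 0" "r * norm (v1, v2) < e" "N * r\<^sup>2 * (cmod K)\<^sup>2 < (cmod v2)\<^sup>2"
    using eventually_happens'[OF trivial_limit_at_right_real] by blast
  define v where "v = (of_real r * v1, of_real r * v2)"
  have line: "cline p v \<zeta> = p + (\<zeta> * of_real r * v1, \<zeta> * of_real r * v2)" for \<zeta>
    by (simp add: cline_def v_def prod_eq_iff mult.assoc)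
  have inU: "cline p v \<zeta> \<in> U" if "cmod \<zeta> \<le> 1" for \<zeta>
  proof -
    have "norm (\<zeta> * of_real r * v1, \<zeta> * of_real r * v2) = cmod \<zeta> * (r * norm (v1, v2))"
      using r(1) by (simp add: norm_Pair norm_mult power_mult_distrib real_sqrt_mult
          flip: distrib_left)
    also have "\<dots> \<le> 1 * (r * norm (v1, v2))"
      using that r(1) by (intro mult_right_mono) auto
    also have "\<dots> < e" using r(2) by simp
    finally have "cline p v \<zeta> \<in> ball p e"
      by (metis add_diff_cancel_left' dist_commute dist_norm line mem_ball)
    then show ?thesis using e by blast
  qed
  have h_line: "h (cline p v \<zeta>) = h p + (of_real r)\<^sup>2 * K * \<zeta>\<^sup>2" for \<zeta>
    unfolding h line K_def v1_def v2_def by (simp add: power2_eq_square algebra_simps)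
  \<comment> \<open>By maximality \<open>\<phi> - \<phi> p\<close> is at most
    \<open>\<psi> - \<psi> p\<close> on the disc; \<open>g\<close> is the resulting bound on its
    boundary circle.\<close>
  define g where "g t = \<phi> p + N * ((cmod (h p + (of_real r)\<^sup>2 * K * cis (real 2 * t)))\<^sup>2 - (cmod (h p))\<^sup>2)
      - ((cmod (snd p + of_real r * v2 * cis (real 1 * t)))\<^sup>2 - (cmod (snd p))\<^sup>2)" for t
  define I where "I = 2*pi * \<phi> p + N * (2*pi * (cmod ((of_real r)\<^sup>2 * K))\<^sup>2)
      - 2*pi * (cmod (of_real r * v2))\<^sup>2"
  have "(g has_integral I) {0..2*pi}"
    unfolding g_def I_def
    by (intro has_integral_diff has_integral_add has_integral_mult_right has_integral_norm_square_cis)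
      (use has_integral_const_real[of "\<phi> p" 0 "2*pi"] in simp_all)
  moreover have "\<phi> (cline p v (cis t)) \<le> g t" for t
  proof -
    have "snd (cline p v (cis t)) = snd p + of_real r * v2 * cis t"
      by (simp add: line)
    then show ?thesis
      using max[OF inU, of "cis t"] by (simp add: \<psi>_def h_line g_def Complex.DeMoivre right_diff_distrib)
  qed
  ultimately have "\<phi> p \<le> I / (2*pi)"
    using inU U by (intro plurisubharmonic_le_majorant_mean[OF psh cont]) auto
  also have "I / (2*pi) = \<phi> p + r\<^sup>2 * (N * r\<^sup>2 * (cmod K)\<^sup>2 - (cmod v2)\<^sup>2)"
    using r(1) by (simp add: I_def field_simps norm_mult norm_power power2_eq_square)
  also have "\<dots> < \<phi> p"
    using r by (simp add: mult_less_0_iff)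
  finally show False by simp
qed

section \<open>Quadrics with negative Levi form\<close>

text \<open>\<open>(Im z)^2\<close> is half of \<open>|z|^2 - Re (z^2)\<close>, and
  \<open>(Re w)^2\<close> is half of \<open>|w|^2 + Re (w^2)\<close>. This splits the real quadric
  into a pluriharmonic part and the Levi part \<open>C/2 |z|^2 - a/2 |w|^2\<close>.\<close>

lemma complex_quadric_expansion:
  fixes b c C a :: real
  shows "Re ((1 - \<i> * of_real b) * z - of_real c * w - of_real (C/2) * z\<^sup>2 - of_real (a/2) * w\<^sup>2)
      + C/2 * (cmod z)\<^sup>2 - a/2 * (cmod w)\<^sup>2
    = Re z + b * Im z + C * (Im z)\<^sup>2 - c * Re w - a * (Re w)\<^sup>2"
  unfolding cmod_power2 by (simp add: power2_eq_square algebra_simps) argo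

text \<open>On the complex tangent line \<open>(1 - \<i> b) z = c w\<close> at 0 one has
  \<open>|z| \<le> |c| |w|\<close>, so the Levi part is at most \<open>(C c^2 - a)/2 |w|^2\<close>,
  negative by \<open>levi\<close>. The factor 64 leaves room for the curvature of the discs.\<close>

lemma semitube_not_pseudoconvex_if_negative_Levi:
  fixes B :: "(complex \<times> real) set" and a b c C r :: real
  assumes pc: "pseudoconvex (semitube B)"
    and zero: "(0, 0) \<notin> B"
    and pos: "a > 0" "C > 0" "r > 0"
    and levi: "64 * C * c\<^sup>2 \<le> a"
    and inside: "\<And>z u. cmod z \<le> r \<Longrightarrow> \<bar>u\<bar> \<le> r \<Longrightarrow>
        Re z + b * Im z + C * (Im z)\<^sup>2 - c * u - a * u\<^sup>2 < 0 \<Longrightarrow> (z, u) \<in> B"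
  shows False
proof -
  let ?\<Omega> = "semitube B"
  obtain \<phi> where cont: "continuous_on ?\<Omega> \<phi>" and psh: "plurisubharmonic_on ?\<Omega> \<phi>"
    and exh: "\<And>c. compact {z \<in> ?\<Omega>. \<phi> z \<le> c}"
    using pc unfolding pseudoconvex_def by blast
  define P where "P p = (1 - \<i> * of_real b) * fst p - of_real c * snd p
      - of_real (C/2) * (fst p)\<^sup>2 - of_real (a/2) * (snd p)\<^sup>2" for p :: "complex \<times> complex"
  define G where "G p = Re (P p) + C/2 * (cmod (fst p))\<^sup>2 - a/2 * (cmod (snd p))\<^sup>2" for p
  have contP [continuous_intros]: "continuous_on S P" for S
    unfolding P_def by (intro continuous_intros)
  have contG [continuous_intros]: "continuous_on S G" for S
    unfolding G_def by (intro continuous_intros)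

  have in_\<Omega>: "p \<in> ?\<Omega>" if "cmod (fst p) \<le> r" "cmod (snd p) \<le> r" "G p < 0" for p
  proof -
    have "(fst p, Re (snd p)) \<in> B"
      using that inside[of "fst p" "Re (snd p)"] complex_quadric_expansion[of b "fst p" c "snd p" C a]
        abs_Re_le_cmod[of "snd p"]
      by (simp add: G_def P_def)
    then show ?thesis by (simp add: semitube_def case_prod_beta)
  qed

  \<comment> \<open>\<open>C * R \<le> 1\<close> lets the linear term of \<open>P\<close> absorb the
    \<open>z1^2\<close> term, and keeps dP/dz1 nonzero where \<open>|z1| < R\<close>.\<close>
  define R where "R = min r (1/C)"
  have R: "R > 0" "R \<le> r" "C * R \<le> 1"
    using pos by (auto simp: R_def min_def field_simps)
  \<comment> \<open>Twice \<open>1/2 + (|b| + 2)\<close>: in units of \<open>s\<close>, the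
    thickness of the disc plus the bound on \<open>P zs\<close>. The doubling, also present in
    \<open>m\<close>, comes from absorbing \<open>C/2 |z1|^2\<close> into
    \<open>|z1|/2\<close>.\<close>
  define E where "E = 2 * \<bar>b\<bar> + 5"
  have E: "E > 0" by (simp add: E_def add_nonneg_pos)

  \<comment> \<open>The conditions on \<open>\<rho>\<close> in turn keep \<open>z2\<close> in the
    range of \<open>inside\<close>, keep \<open>|z1|\<close> below \<open>R\<close> on the discs,
    and yield \<open>C * m\<^sup>2 \<le> a/4\<close>.\<close>
  have "\<forall>\<^sub>F \<rho> in at_right 0. \<rho> < r"
    using pos by (intro eventually_at_right_isCont_less) auto
  moreover have "\<forall>\<^sub>F \<rho> in at_right 0. (2*\<bar>c\<bar> + a*\<rho>) * \<rho> < R/2"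
    using R by (intro eventually_at_right_isCont_less) auto
  moreover have "\<forall>\<^sub>F \<rho> in at_right 0. 16 * C * a * \<rho>\<^sup>2 < 1"
    by (intro eventually_at_right_isCont_less) auto
  moreover have "\<forall>\<^sub>F \<rho> in at_right (0::real). \<rho> > 0"
    by (simp add: eventually_at_right_less)
  ultimately have "\<forall>\<^sub>F \<rho> in at_right (0::real). \<rho> > 0 \<and> \<rho> < r \<and> (2*\<bar>c\<bar> + a*\<rho>) * \<rho> < R/2 \<and>
      16 * C * a * \<rho>\<^sup>2 < 1"
    by eventually_elim auto
  then obtain \<rho> where \<rho>: "\<rho> > 0" "\<rho> < r" "(2*\<bar>c\<bar> + a*\<rho>) * \<rho> < R/2" "16 * C * a * \<rho>\<^sup>2 < 1"
    using eventually_happens'[OF trivial_limit_at_right_real] by blast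
  define m where "m = 2*\<bar>c\<bar> + a*\<rho>"
  have m: "m \<ge> 0" "C * m\<^sup>2 \<le> a/4"
  proof -
    show "m \<ge> 0" using pos \<rho> by (simp add: m_def)
    have "0 \<le> (2*\<bar>c\<bar> - a*\<rho>)\<^sup>2" by simp
    then have "m\<^sup>2 \<le> 8 * c\<^sup>2 + 2 * a\<^sup>2 * \<rho>\<^sup>2"
      by (simp add: m_def power2_eq_square algebra_simps)
    then have "C * m\<^sup>2 \<le> C * (8 * c\<^sup>2 + 2 * a\<^sup>2 * \<rho>\<^sup>2)"
      using pos by simp
    also have "\<dots> = (64 * C * c\<^sup>2)/8 + a/8 * (16 * C * a * \<rho>\<^sup>2)"
      by (simp add: power2_eq_square algebra_simps)
    also have "\<dots> \<le> a/8 + a/8 * 1"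
      using levi \<rho> pos by (intro add_mono mult_left_mono) auto
    finally show "C * m\<^sup>2 \<le> a/4" by simp
  qed

  \<comment> \<open>A compact set containing the rims \<open>|z2| = \<rho>\<close> of all the
    thickened discs; being independent of \<open>s\<close>, it gives one bound \<open>M\<close> for
    all of them.\<close>
  define K where "K = {p. cmod (fst p) \<le> R \<and> cmod (snd p) = \<rho> \<and> G p \<le> - (a/4 * \<rho>\<^sup>2)}"
  have "compact (cball 0 R \<times> cball 0 \<rho> :: (complex \<times> complex) set)"
    by (intro compact_Times compact_cball)
  moreover have "closed K"
    unfolding K_def by (intro closed_Collect_conj closed_Collect_le closed_Collect_eq continuous_intros)
  moreover have "K \<subseteq> cball 0 R \<times> cball 0 \<rho>" by (auto simp: K_def)
  ultimately have "compact K"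
    by (metis compact_Int_closed inf.absorb_iff2)
  moreover have "K \<subseteq> ?\<Omega>"
    using R \<rho> pos by (auto simp: K_def intro!: in_\<Omega> elim!: order.strict_trans1)
  ultimately have "bounded (\<phi> ` K)"
    by (meson compact_continuous_image compact_imp_bounded cont continuous_on_subset)
  then obtain M where M: "\<And>p. p \<in> K \<Longrightarrow> \<phi> p \<le> M"
    by (metis bounded_imp_bdd_above bdd_above.E imageI)

  \<comment> \<open>The maximum principle on the disc \<open>P = P zs\<close> through
    \<open>(-s, 0)\<close>: the value there is controlled by the rim, and
    \<open>\<rho>\<^sup>2\<close> is the cost of the added \<open>|z2|^2\<close>.\<close>
  have bound: "\<phi> (- of_real s, 0) \<le> M + \<rho>\<^sup>2"
    if s: "s > 0" "s \<le> R" "E * s < R/2" "2 * C * E\<^sup>2 * s < 1" "C * s \<le> 2" for s :: real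
  proof -
    define zs :: "complex \<times> complex" where "zs = (- of_real s, 0)"
    \<comment> \<open>The thickened disc and its interior. Since \<open>Re (P zs) \<le> - s\<close>,
      thickness \<open>s/2\<close> still leaves \<open>Re (P p) \<le> - s/2\<close> on
      \<open>Q\<close>.\<close>
    define Q where "Q = {p. cmod (fst p) \<le> R \<and> cmod (snd p) \<le> \<rho> \<and> cmod (P p - P zs) \<le> s/2}"
    define U where "U = {p. cmod (fst p) < R \<and> cmod (snd p) < \<rho> \<and> cmod (P p - P zs) < s/2}"
    have RePzs: "Re (P zs) \<le> - s"
      using s pos by (simp add: P_def zs_def power2_eq_square)
    have normPzs: "cmod (P zs) \<le> (\<bar>b\<bar> + 2) * s"
    proof -
      have "P zs = - of_real (s + C/2 * s\<^sup>2) + \<i> * of_real (b * s)"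
        by (simp add: P_def zs_def power2_eq_square algebra_simps)
      also have "cmod \<dots> \<le> \<bar>s + C/2 * s\<^sup>2\<bar> + \<bar>b * s\<bar>"
        by (intro norm_triangle_le add_mono) (simp_all only: norm_mult norm_minus_cancel norm_of_real norm_ii mult_1 order_refl)
      finally have "cmod (P zs) \<le> (s + C/2 * s\<^sup>2) + \<bar>b\<bar> * s"
        using s pos by (simp add: abs_mult)
      moreover have "s + C/2 * s\<^sup>2 \<le> 2 * s"
        using mult_right_mono[OF s(5), of "s/2"] s by (simp add: power2_eq_square algebra_simps)
      ultimately show ?thesis
        by (simp add: algebra_simps)
    qed
    \<comment> \<open>Solving the formula for \<open>P\<close> for its term linear in
      \<open>z1\<close> shows that the disc is flat over the \<open>z2\<close>-plane, with slope at
      most \<open>m\<close> up to an error of order \<open>s\<close>.\<close>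
    have z1: "cmod (fst p) \<le> m * cmod (snd p) + E * s" if "p \<in> Q" for p
    proof -
      define x y where "x = cmod (fst p)" and "y = cmod (snd p)"
      have xy: "0 \<le> x" "x \<le> R" "0 \<le> y" "y \<le> \<rho>" "cmod (P p - P zs) \<le> s/2"
        using that by (auto simp: Q_def x_def y_def)
      have "(1 - \<i> * of_real b) * fst p = (P p - P zs) + P zs + of_real c * snd p
          + of_real (C/2) * (fst p)\<^sup>2 + of_real (a/2) * (snd p)\<^sup>2"
        by (simp add: P_def)
      then have "cmod ((1 - \<i> * of_real b) * fst p) \<le> cmod (P p - P zs) + cmod (P zs)
          + cmod (of_real c * snd p) + cmod (of_real (C/2) * (fst p)\<^sup>2) + cmod (of_real (a/2) * (snd p)\<^sup>2)"
        by (metis norm_triangle_le norm_triangle_ineq add_right_mono order_refl)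
      then have "cmod (1 - \<i> * of_real b) * x \<le> s/2 + (\<bar>b\<bar> + 2) * s + \<bar>c\<bar> * y + C/2 * x\<^sup>2 + a/2 * y\<^sup>2"
        using xy(5) normPzs pos by (simp add: norm_mult norm_power x_def y_def)
      moreover have "1 * x \<le> cmod (1 - \<i> * of_real b) * x"
        using abs_Re_le_cmod[of "1 - \<i> * of_real b"] xy by (intro mult_right_mono) auto
      moreover have "C * x\<^sup>2 \<le> x"
      proof -
        have "C * x \<le> C * R" using xy pos by simp
        then have "C * x \<le> 1" using R by simp
        then show ?thesis
          using mult_right_mono[of "C*x" 1 x] xy by (simp add: power2_eq_square mult_ac)
      qed
      moreover have "a * y\<^sup>2 \<le> a * \<rho> * y"
        using xy pos by (simp add: power2_eq_square mult_right_mono)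
      ultimately show ?thesis
        by (simp add: m_def E_def algebra_simps flip: x_def y_def)
    qed
    have fst_lt: "cmod (fst p) < R" if "p \<in> Q" for p
    proof -
      have "m * cmod (snd p) \<le> m * \<rho>"
        using that m by (intro mult_left_mono) (auto simp: Q_def)
      then show ?thesis using z1[OF that] s \<rho> by (simp add: m_def)
    qed
    \<comment> \<open>Half of \<open>a/2 |z2|^2\<close> pays for the part of
      \<open>C/2 |z1|^2\<close> due to the slope \<open>m\<close>, and
      \<open>Re P \<le> - s/2\<close> pays for the part due to \<open>E * s\<close>; the other half
      remains.\<close>
    have G_le: "G p \<le> - (a/4 * (cmod (snd p))\<^sup>2)" "G p < 0" if "p \<in> Q" for p
    proof -
      define x y where "x = cmod (fst p)" and "y = cmod (snd p)"
      have "x\<^sup>2 \<le> (m * y + E * s)\<^sup>2"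
        using z1[OF that] by (intro power_mono) (auto simp: x_def y_def)
      also have "\<dots> \<le> 2 * m\<^sup>2 * y\<^sup>2 + 2 * E\<^sup>2 * s\<^sup>2"
        using sum_squares_bound[of "m * y" "E * s"] by (simp add: power2_eq_square algebra_simps)
      finally have "C/2 * x\<^sup>2 \<le> C/2 * (2 * m\<^sup>2 * y\<^sup>2 + 2 * E\<^sup>2 * s\<^sup>2)"
        using pos by (intro mult_left_mono) auto
      also have "\<dots> = (C * m\<^sup>2) * y\<^sup>2 + (2 * C * E\<^sup>2 * s) * (s/2)"
        by (simp add: power2_eq_square algebra_simps)
      also have "\<dots> < a/4 * y\<^sup>2 + 1 * (s/2)"
        using m s by (intro add_le_less_mono mult_right_mono mult_strict_right_mono) auto
      finally have "C/2 * x\<^sup>2 < a/4 * y\<^sup>2 + s/2" by simp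
      moreover have "Re (P p) \<le> - s/2"
        using that RePzs complex_Re_le_cmod[of "P p - P zs"] by (auto simp: Q_def)
      ultimately have "G p < - (a/4 * y\<^sup>2)"
        by (simp add: G_def flip: x_def y_def)
      moreover have "a/4 * y\<^sup>2 \<ge> 0" using pos by simp
      ultimately show "G p \<le> - (a/4 * (cmod (snd p))\<^sup>2)" "G p < 0"
        unfolding y_def by linarith+
    qed
    have Q\<Omega>: "Q \<subseteq> ?\<Omega>"
    proof
      fix p assume "p \<in> Q"
      then show "p \<in> ?\<Omega>"
        using R \<rho> G_le(2)[of p] by (intro in_\<Omega>) (auto simp: Q_def)
    qed
    have "compact (cball 0 R \<times> cball 0 \<rho> :: (complex \<times> complex) set)"
      by (intro compact_Times compact_cball)
    moreover have "closed Q"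
      unfolding Q_def by (intro closed_Collect_conj closed_Collect_le continuous_intros)
    moreover have "Q \<subseteq> cball 0 R \<times> cball 0 \<rho>" by (auto simp: Q_def)
    ultimately have compQ: "compact Q"
      by (metis compact_Int_closed inf.absorb_iff2)
    have zsQ: "zs \<in> Q" using s \<rho> by (simp add: Q_def zs_def)
    have contQ: "continuous_on Q \<phi>" using cont Q\<Omega> continuous_on_subset by blast
    then have "bounded (\<phi> ` Q)"
      by (meson compQ compact_continuous_image compact_imp_bounded)
    then obtain T where T: "\<And>p. p \<in> Q \<Longrightarrow> \<phi> p \<le> T"
      by (metis bounded_imp_bdd_above bdd_above.E imageI)
    \<comment> \<open>Makes the penalty on the wall \<open>|P - P zs| = s/2\<close> equal to
      \<open>T - \<phi> zs + \<rho>\<^sup>2 + 1\<close>, so that no point of the wall can beat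
      \<open>zs\<close>.\<close>
    define N where "N = (T - \<phi> zs + \<rho>\<^sup>2 + 1) / (s/2)\<^sup>2"
    define \<psi> where "\<psi> p = N * (cmod (P p - P zs))\<^sup>2 - (cmod (snd p))\<^sup>2" for p
    have "continuous_on Q (\<lambda>p. \<phi> p - \<psi> p)"
      unfolding \<psi>_def by (intro continuous_intros contQ)
    then obtain p where p: "p \<in> Q" and max: "\<And>q. q \<in> Q \<Longrightarrow> \<phi> q - \<psi> q \<le> \<phi> p - \<psi> p"
      using continuous_attains_sup[OF compQ] zsQ by blast
    have zs_le: "\<phi> zs \<le> \<phi> p - \<psi> p"
      using max[OF zsQ] by (simp add: \<psi>_def zs_def)
    have snd_le: "(cmod (snd p))\<^sup>2 \<le> \<rho>\<^sup>2"
      using p by (intro power_mono) (auto simp: Q_def)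
    \<comment> \<open>Where the maximum can lie: the wall is excluded by \<open>N\<close>, the face
      \<open>|z1| = R\<close> by \<open>fst_lt\<close>, and the interior by the Levi form. Only the
      rim is left, where the bound \<open>M\<close> applies.\<close>
    have "cmod (P p - P zs) \<noteq> s/2"
    proof
      assume eq: "cmod (P p - P zs) = s/2"
      then have "\<psi> p = T - \<phi> zs + \<rho>\<^sup>2 + 1 - (cmod (snd p))\<^sup>2"
        unfolding \<psi>_def N_def eq using s by simp
      then show False using zs_le T[OF p] snd_le by simp
    qed
    moreover have "\<phi> zs \<le> M + \<rho>\<^sup>2" if "cmod (snd p) = \<rho>"
    proof -
      have "p \<in> K" using p that G_le(1)[OF p] by (auto simp: K_def Q_def)
      then have "\<phi> p \<le> M" by (rule M)
      moreover have "N \<ge> 0"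
        using T[OF zsQ] by (simp add: N_def)
      ultimately show ?thesis using zs_le snd_le by (simp add: \<psi>_def) (smt (verit) mult_nonneg_nonneg zero_le_power2)
    qed
    moreover have False if "cmod (snd p) < \<rho>" "cmod (P p - P zs) < s/2"
    proof (rule plurisubharmonic_no_interior_max[OF psh cont, of U p N "\<lambda>p. P p - P zs"
          "- P zs" "1 - \<i> * of_real b" "- of_real c" "- of_real (C/2)" "- of_real (a/2)"])
      show "open U"
        unfolding U_def by (intro open_Collect_conj open_Collect_less continuous_intros)
      show "U \<subseteq> ?\<Omega>" using Q\<Omega> by (force simp: U_def Q_def)
      show "p \<in> U" using that fst_lt[OF p] by (simp add: U_def)
      show "\<phi> z - (N * (cmod (P z - P zs))\<^sup>2 - (cmod (snd z))\<^sup>2)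
          \<le> \<phi> p - (N * (cmod (P p - P zs))\<^sup>2 - (cmod (snd p))\<^sup>2)" if "z \<in> U" for z
        using max[of z] that by (simp add: U_def Q_def \<psi>_def)
      show "P z - P zs = - P zs + (1 - \<i> * of_real b) * fst z + - of_real c * snd z
          + - of_real (C/2) * (fst z)\<^sup>2 + - of_real (a/2) * (snd z)\<^sup>2" for z
        by (simp add: P_def)
      show "1 - \<i> * of_real b + 2 * - of_real (C/2) * fst p \<noteq> 0"
      proof
        assume "1 - \<i> * of_real b + 2 * - of_real (C/2) * fst p = 0"
        then have "Re (1 - \<i> * of_real b + 2 * - of_real (C/2) * fst p) = 0" by simp
        then have "1 = C * Re (fst p)" by simp
        also have "\<dots> < C * R"
          using fst_lt[OF p] complex_Re_le_cmod[of "fst p"] pos by simp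
        finally show False using R by simp
      qed
    qed
    ultimately show ?thesis
      using p by (force simp: Q_def zs_def)
  qed

  \<comment> \<open>A compact sublevel set is closed in the whole space, so the limit
    \<open>(0, 0)\<close> of the points \<open>(-s, 0)\<close> would have to lie in the
    semitube.\<close>
  define S where "S = {z \<in> ?\<Omega>. \<phi> z \<le> M + \<rho>\<^sup>2}"
  have "\<forall>\<^sub>F s in at_right 0. s < R" "\<forall>\<^sub>F s in at_right 0. E * s < R/2"
    "\<forall>\<^sub>F s in at_right 0. 2 * C * E\<^sup>2 * s < 1" "\<forall>\<^sub>F s in at_right 0. C * s < 2"
    using R by (auto intro!: eventually_at_right_isCont_less)
  moreover have "\<forall>\<^sub>F s in at_right (0::real). s > 0"
    by (simp add: eventually_at_right_less)
  ultimately have "\<forall>\<^sub>F s in at_right (0::real). (- complex_of_real s, 0) \<in> S"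
  proof eventually_elim
    case (elim s)
    have "G (- of_real s, 0) = - s"
      using complex_quadric_expansion[of b "- of_real s" c 0 C a] by (simp add: G_def P_def)
    then have "(- of_real s, 0) \<in> ?\<Omega>"
      using elim R pos by (intro in_\<Omega>) auto
    then show ?case using bound[of s] elim by (auto simp: S_def)
  qed
  moreover have "closed S" unfolding S_def by (intro compact_imp_closed exh)
  moreover have "((\<lambda>s. (- complex_of_real s, 0)) \<longlongrightarrow> (- complex_of_real 0, 0)) (at_right 0)"
    by (intro tendsto_intros)
  ultimately have "(- complex_of_real 0, 0) \<in> S"
    by (intro Lim_in_closed_set[where F = "at_right (0::real)"]) auto
  then show False using zero by (simp add: S_def semitube_def)
qed

section \<open>Filling the missing leg of a right triangle\<close>

text \<open>The triangle has vertices \<open>(0, 0)\<close>, \<open>(0, l)\<close> and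
  \<open>(-d, l)\<close>. A hole on the \<open>u\<close>-axis forces a quadric to touch the
  complement of \<open>B\<close> at some point; translations in \<open>pc\<close> bring that unknown
  point to the origin.\<close>

lemma semitube_right_triangle_leg:
  fixes B :: "(complex \<times> real) set" and d l :: real
  assumes pc: "\<And>q. pseudoconvex (semitube ((\<lambda>p. p - q) ` B))"
    and opn: "open B" and pos: "d > 0" "l > 0"
    and hyp: "\<And>u. 0 \<le> u \<Longrightarrow> u \<le> l \<Longrightarrow> (- of_real (d/l * u), u) \<in> B"
    and leg: "\<And>x. - d \<le> x \<Longrightarrow> x \<le> 0 \<Longrightarrow> (of_real x, l) \<in> B"
    and u0: "0 \<le> u0" "u0 \<le> l"
  shows "(0, u0) \<in> B"
proof (rule ccontr)
  assume hole: "(0, u0) \<notin> B"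
  define T :: "(complex \<times> real) set" where
    "T = (\<lambda>u. (- of_real (d/l * u), u)) ` {0..l} \<union> (\<lambda>x. (of_real x, l)) ` {-d..0}"
  have "compact T"
    unfolding T_def by (intro compact_Un compact_continuous_image continuous_intros compact_Icc)
  moreover have "T \<subseteq> B" using hyp leg by (auto simp: T_def)
  ultimately obtain \<delta> where \<delta>: "\<delta> > 0" "(\<Union>x\<in>T. ball x \<delta>) \<subseteq> B"
    using compact_subset_open_imp_ball_epsilon_subset opn by blast
  \<comment> \<open>A square of half-side \<open>\<delta>/2\<close> lies inside a disc of radius
    \<open>\<delta>\<close>.\<close>
  define \<eta> where "\<eta> = \<delta>/2"
  have \<eta>: "\<eta> > 0" using \<delta> by (simp add: \<eta>_def)
  have near: "(z, u) \<in> B" if "(of_real x, u) \<in> T" "\<bar>Re z - x\<bar> \<le> \<eta>" "\<bar>Im z\<bar> \<le> \<eta>" for x z u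
  proof -
    have "(dist (of_real x) z)\<^sup>2 = (Re z - x)\<^sup>2 + (Im z)\<^sup>2"
      by (simp add: dist_norm cmod_power2 power2_commute)
    also have "\<dots> \<le> \<eta>\<^sup>2 + \<eta>\<^sup>2"
      using that by (intro add_mono) (auto simp: abs_le_square_iff[symmetric])
    also have "\<dots> < \<delta>\<^sup>2" using \<delta> by (simp add: \<eta>_def power2_eq_square)
    finally have "dist (of_real x) z < \<delta>"
      using \<delta> by (simp add: power2_less_imp_less)
    then have "(z, u) \<in> ball (of_real x, u) \<delta>" by (simp add: dist_Pair_Pair)
    then show ?thesis using \<delta> that by blast
  qed

  \<comment> \<open>On the faces \<open>|y| = \<eta>\<close> the term \<open>C y^2\<close> equals
    \<open>d + 1\<close>, which outweighs \<open>x \<ge> -d\<close> and \<open>a u^2 < 1\<close>, so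
    \<open>G > 0\<close> there.\<close>
  define C where "C = (d + 1) / \<eta>\<^sup>2"
  have C: "C > 0" using pos \<eta> by (simp add: C_def)
  \<comment> \<open>The three bounds serve the faces \<open>|y| = \<eta>\<close>, the face
    \<open>x = \<eta>\<close>, and the Levi condition with \<open>c = 2*a*t\<close>.\<close>
  have "\<forall>\<^sub>F a in at_right 0. a * l\<^sup>2 < 1" "\<forall>\<^sub>F a in at_right 0. a * l\<^sup>2 < \<eta>"
    "\<forall>\<^sub>F a in at_right 0. 256 * C * l\<^sup>2 * a < 1"
    using \<eta> by (auto intro!: eventually_at_right_isCont_less)
  moreover have "\<forall>\<^sub>F a in at_right (0::real). a > 0"
    by (simp add: eventually_at_right_less)
  ultimately have "\<forall>\<^sub>F a in at_right (0::real). a > 0 \<and> a * l\<^sup>2 < 1 \<and> a * l\<^sup>2 < \<eta> \<and> 256 * C * l\<^sup>2 * a < 1"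
    by eventually_elim auto
  then obtain a where a: "a > 0" "a * l\<^sup>2 < 1" "a * l\<^sup>2 < \<eta>" "256 * C * l\<^sup>2 * a < 1"
    using eventually_happens'[OF trivial_limit_at_right_real] by blast

  define G where "G p = Re (fst p) + C * (Im (fst p))\<^sup>2 - a * (snd p)\<^sup>2" for p :: "complex \<times> real"
  define K where "K = {p :: complex \<times> real. 0 \<le> snd p \<and> snd p \<le> l \<and> - \<eta> \<le> Im (fst p) \<and> Im (fst p) \<le> \<eta> \<and>
      - (d/l * snd p) \<le> Re (fst p) \<and> Re (fst p) \<le> \<eta>}"
  define K' where "K' = {p :: complex \<times> real. 0 < snd p \<and> snd p < l \<and> - \<eta> < Im (fst p) \<and> Im (fst p) < \<eta> \<and>
      - (d/l * snd p) < Re (fst p) \<and> Re (fst p) < \<eta>}"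
  have dl: "d/l * u \<le> d" if "u \<le> l" for u
    using that pos by (simp add: field_simps)
  have "closed K"
    unfolding K_def by (intro closed_Collect_conj closed_Collect_le continuous_intros)
  moreover have "K \<subseteq> cbox (Complex (-d) (-\<eta>), 0) (Complex \<eta> \<eta>, l)"
  proof
    fix p assume p: "p \<in> K"
    then have "- d \<le> Re (fst p)" using dl[of "snd p"] by (auto simp: K_def)
    with p show "p \<in> cbox (Complex (-d) (-\<eta>), 0) (Complex \<eta> \<eta>, l)"
      by (cases p) (simp add: K_def cbox_Pair_eq in_cbox_complex_iff)
  qed
  ultimately have "compact K"
    by (metis compact_Int_closed compact_cbox inf.absorb_iff2)
  then have "compact (K - B)" using opn by (rule compact_diff)
  moreover have q0: "(0, u0) \<in> K - B" using hole u0 pos \<eta> by (simp add: K_def)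
  moreover have "continuous_on (K - B) G"
    unfolding G_def by (intro continuous_intros)
  ultimately obtain q where q: "q \<in> K - B" and min: "\<And>p. p \<in> K - B \<Longrightarrow> G q \<le> G p"
    using continuous_attains_inf[of "K - B" G] by blast
  obtain w t where wt: "q = (w, t)" by (cases q)
  have K: "0 \<le> t" "t \<le> l" "\<bar>Im w\<bar> \<le> \<eta>" "- (d/l * t) \<le> Re w" "Re w \<le> \<eta>" and qB: "(w, t) \<notin> B"
    using q by (auto simp: wt K_def)
  have Gq: "Re w + C * (Im w)\<^sup>2 - a * t\<^sup>2 \<le> 0"
  proof -
    have "G q \<le> - (a * u0\<^sup>2)" using min[OF q0] by (simp add: G_def)
    also have "\<dots> \<le> 0" using a by simp
    finally show ?thesis by (simp add: G_def wt)
  qed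
  have at: "a * t\<^sup>2 \<le> a * l\<^sup>2"
    using K a by (intro mult_left_mono power_mono) auto
  \<comment> \<open>The minimiser avoids every face of \<open>K\<close>: the slanted face, the top
    and the bottom lie within the tube around \<open>T\<close>, hence in \<open>B\<close>; on the
    others \<open>G > 0\<close> contradicts \<open>Gq\<close>.\<close>
  have "Re w \<noteq> - (d/l * t)"
  proof
    assume eq: "Re w = - (d/l * t)"
    have "(of_real (- (d/l * t)), t) \<in> T" using K by (auto simp: T_def)
    then show False using near[of "- (d/l * t)" t w] K eq \<eta> qB by simp
  qed
  moreover have "t \<noteq> l"
  proof
    assume eq: "t = l"
    have "(of_real (min (Re w) 0), t) \<in> T"
      using K pos by (auto simp: T_def eq)
    then show False using near[of "min (Re w) 0" t w] K \<eta> qB by (auto simp: min_def split: if_splits)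
  qed
  moreover have "t \<noteq> 0"
  proof
    assume eq: "t = 0"
    have "(of_real 0, t) \<in> T" using pos eq by (auto simp: T_def image_iff intro!: bexI[of _ 0])
    then show False using near[of 0 t w] K eq qB by simp
  qed
  moreover have "\<bar>Im w\<bar> \<noteq> \<eta>"
  proof
    assume "\<bar>Im w\<bar> = \<eta>"
    then have "C * (Im w)\<^sup>2 = d + 1" using \<eta> by (simp add: C_def flip: power2_abs[of "Im w"])
    then show False using Gq at a K dl[of t] by linarith
  qed
  moreover have "Re w \<noteq> \<eta>"
  proof
    assume "Re w = \<eta>"
    moreover have "C * (Im w)\<^sup>2 \<ge> 0" using C by simp
    ultimately show False using Gq at a by linarith
  qed
  ultimately have "q \<in> K'" using K by (auto simp: wt K'_def)
  moreover have "open K'"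
    unfolding K'_def by (intro open_Collect_conj open_Collect_less continuous_intros)
  ultimately obtain e where e: "e > 0" "ball q e \<subseteq> K'" using openE by blast
  show False
  \<comment> \<open>The coefficients are those of the expansion of \<open>G\<close> around
    \<open>q\<close>. Points near \<open>q\<close> with a smaller value of \<open>G\<close> lie in
    \<open>B\<close> by minimality; radius \<open>e/3\<close> in both factors stays inside
    \<open>ball q e\<close>.\<close>
  proof (rule semitube_not_pseudoconvex_if_negative_Levi[OF pc[of q], of a C "e/3" "2*a*t" "2*C*Im w"])
    show "(0, 0) \<notin> (\<lambda>p. p - q) ` B" using qB wt by (auto simp: prod_eq_iff)
    show "64 * C * (2*a*t)\<^sup>2 \<le> a"
    proof -
      have "64 * C * (2*a*t)\<^sup>2 = 256 * C * a * (a * t\<^sup>2)" by (simp add: power2_eq_square)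
      also have "\<dots> \<le> 256 * C * a * (a * l\<^sup>2)" using at C a by (intro mult_left_mono) auto
      also have "\<dots> = a * (256 * C * l\<^sup>2 * a)" by simp
      also have "\<dots> \<le> a * 1" using a by (intro mult_left_mono) auto
      finally show ?thesis by simp
    qed
    fix z u assume zu: "cmod z \<le> e/3" "\<bar>u\<bar> \<le> e/3"
      and neg: "Re z + 2 * C * Im w * Im z + C * (Im z)\<^sup>2 - 2 * a * t * u - a * u\<^sup>2 < 0"
    have "norm (z, u) \<le> cmod z + norm u" by (rule norm_Pair_le)
    also have "\<dots> < e" using zu e by simp
    finally have "q + (z, u) \<in> ball q e"
      by (metis add_diff_cancel_left' dist_commute dist_norm mem_ball)
    then have "q + (z, u) \<in> K" using e by (force simp: K_def K'_def)
    moreover have "G (q + (z, u)) < G q"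
      using neg by (simp add: G_def wt power2_eq_square algebra_simps)
    ultimately have "q + (z, u) \<in> B" using min[of "q + (z, u)"] by force
    then show "(z, u) \<in> (\<lambda>p. p - q) ` B" by (force intro!: image_eqI[of _ _ "q + (z, u)"])
  qed (use a C e in auto)
qed

section \<open>Moving right triangles to normal position\<close>

text \<open>\<open>A\<close> reads off coordinates in an orthonormal frame at \<open>x\<close>:
  \<open>f1\<close> and \<open>f3\<close> along the legs, \<open>f2\<close> completing them. The
  last conclusion makes \<open>A\<close> carry segments to segments.\<close>

lemma exists_isometry_right_triangle:
  fixes x y p :: "complex \<times> real"
  assumes orth: "(p - y) \<bullet> (y - x) = 0" and ne: "y \<noteq> x" "p \<noteq> y"
  obtains A where "isometry_R3 A" "A x = (0, 0)" "A y = (0, norm (y - x))"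
    "A p = (- of_real (norm (p - y)), norm (y - x))"
    "\<And>s v w. A ((1 - s) *\<^sub>R v + s *\<^sub>R w) = (1 - s) *\<^sub>R A v + s *\<^sub>R A w"
proof -
  define f1 where "f1 = (p - y) /\<^sub>R norm (p - y)"
  define f3 where "f3 = (y - x) /\<^sub>R norm (y - x)"
  have f13: "norm f1 = 1" "norm f3 = 1" "f1 \<bullet> f3 = 0"
    using ne orth by (simp_all add: f1_def f3_def)
  have "dim {f1, f3} \<le> card {f1, f3}" by (rule dim_le_card') simp
  also have "\<dots> < DIM(complex \<times> real)" by (simp add: card_insert_if)
  finally obtain g where g: "g \<noteq> 0" "\<And>v. v \<in> span {f1, f3} \<Longrightarrow> orthogonal g v"
    using orthogonal_to_subspace_exists by metis
  define f2 where "f2 = g /\<^sub>R norm g"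
  have f2: "norm f2 = 1" "f2 \<bullet> f1 = 0" "f2 \<bullet> f3 = 0"
    using g(1) g(2)[of f1] g(2)[of f3] by (simp_all add: f2_def span_base orthogonal_def)
  have sq: "f1 \<bullet> f1 = 1" "f2 \<bullet> f2 = 1" "f3 \<bullet> f3 = 1"
    using f13 f2 by (simp_all add: norm_eq_1)
  have neq: "f1 \<noteq> f2" "f1 \<noteq> f3" "f2 \<noteq> f3" using f13 f2 sq by auto
  let ?S = "{f1, f2, f3}"
  have po: "pairwise orthogonal ?S"
    using f13 f2 by (auto simp: pairwise_insert orthogonal_def inner_commute)
  have "independent ?S"
    using po f13 f2 by (intro pairwise_orthogonal_independent) auto
  then have sp: "span ?S = UNIV"
    using card_ge_dim_independent[of ?S UNIV] neq by auto
  have parseval: "(norm v)\<^sup>2 = (v \<bullet> f1)\<^sup>2 + (v \<bullet> f2)\<^sup>2 + (v \<bullet> f3)\<^sup>2" for v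
  proof -
    have "(\<Sum>i\<in>?S. (v \<bullet> i) *\<^sub>R i) = v"
      using po f13 f2 sp by (intro orthonormal_basis_expand) auto
    then have v: "v = (v \<bullet> f1) *\<^sub>R f1 + (v \<bullet> f2) *\<^sub>R f2 + (v \<bullet> f3) *\<^sub>R f3"
      using neq by (simp add: add.assoc)
    have "(norm v)\<^sup>2 = v \<bullet> v" by (simp add: power2_norm_eq_inner)
    also have "\<dots> = v \<bullet> ((v \<bullet> f1) *\<^sub>R f1 + (v \<bullet> f2) *\<^sub>R f2 + (v \<bullet> f3) *\<^sub>R f3)"
      using v by simp
    finally show ?thesis
      by (simp add: inner_add_right power2_eq_square)
  qed
  \<comment> \<open>The minus sign puts the triangle in the half plane
    \<open>x \<le> 0\<close>.\<close>
  define A where "A v = (Complex (- ((v - x) \<bullet> f1)) ((v - x) \<bullet> f2), (v - x) \<bullet> f3)" for v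
  have "isometry_R3 A"
    unfolding isometry_R3_def
  proof (intro allI)
    fix v w
    have "A v - A w = (Complex (- ((v - w) \<bullet> f1)) ((v - w) \<bullet> f2), (v - w) \<bullet> f3)"
      by (simp add: A_def complex_eq_iff inner_diff_left)
    then have "(norm (A v - A w))\<^sup>2 = (norm (v - w))\<^sup>2"
      by (simp add: norm_Pair cmod_power2 parseval)
    then show "dist (A v) (A w) = dist v w"
      by (simp add: dist_norm)
  qed
  moreover have "A x = (0, 0)" by (simp add: A_def Complex_eq_0)
  moreover have yx: "y - x = norm (y - x) *\<^sub>R f3" "p - y = norm (p - y) *\<^sub>R f1"
    using ne by (simp_all add: f1_def f3_def)
  then have 1: "(y - x) \<bullet> f1 = 0" "(y - x) \<bullet> f2 = 0" "(y - x) \<bullet> f3 = norm (y - x)"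
    "(p - y) \<bullet> f1 = norm (p - y)" "(p - y) \<bullet> f2 = 0" "(p - y) \<bullet> f3 = 0"
    by (metis f13 f2 sq inner_commute inner_scaleR_left mult_zero_right mult.right_neutral)+
  then have "A y = (0, norm (y - x))"
    by (simp add: A_def complex_eq_iff)
  moreover have "A p = (- of_real (norm (p - y)), norm (y - x))"
  proof -
    have px: "p - x = (p - y) + (y - x)" by simp
    show ?thesis unfolding A_def px inner_add_left 1 by (simp add: complex_eq_iff)
  qed
  moreover have "A ((1 - s) *\<^sub>R v + s *\<^sub>R w) = (1 - s) *\<^sub>R A v + s *\<^sub>R A w" for s v w
  proof -
    have "(1 - s) *\<^sub>R v + s *\<^sub>R w - x = (1 - s) *\<^sub>R (v - x) + s *\<^sub>R (w - x)"
      by (simp add: algebra_simps)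
    then show ?thesis
      by (simp add: A_def complex_eq_iff inner_add_left)
  qed
  ultimately show ?thesis using that by blast
qed

lemma open_if_pseudoconvex_semitube:
  assumes "pseudoconvex (semitube B)"
  shows "open B"
proof -
  have "open ((\<lambda>p. (fst p, complex_of_real (snd p))) -` semitube B)"
    using assms by (intro open_vimage continuous_intros) (simp add: pseudoconvex_def)
  also have "(\<lambda>p. (fst p, complex_of_real (snd p))) -` semitube B = B"
    by (auto simp: semitube_def)
  finally show ?thesis .
qed

text \<open>The right angle is at \<open>y\<close>. After normalisation the leg lemma applies,
  because a translate of an isometry is again an isometry and \<open>pc\<close> covers it.\<close>

lemma right_triangle_segment_subset:
  fixes D :: "(complex \<times> real) set"
  assumes pc: "\<And>A. isometry_R3 A \<Longrightarrow> pseudoconvex (semitube (A ` D))"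
    and orth: "(p - y) \<bullet> (y - x) = 0"
    and sub: "closed_segment x p \<subseteq> D" "closed_segment p y \<subseteq> D"
  shows "closed_segment x y \<subseteq> D"
proof (cases "y = x \<or> p = y")
  case True
  then show ?thesis using sub by auto
next
  case False
  define d l where "d = norm (p - y)" and "l = norm (y - x)"
  have pos: "d > 0" "l > 0" using False by (auto simp: d_def l_def)
  obtain A where A: "isometry_R3 A" "A x = (0, 0)" "A y = (0, l)" "A p = (- of_real d, l)"
    and aff: "\<And>s v w. A ((1 - s) *\<^sub>R v + s *\<^sub>R w) = (1 - s) *\<^sub>R A v + s *\<^sub>R A w"
    using exists_isometry_right_triangle[OF orth] False unfolding d_def l_def by metis
  have inj: "inj A" using A(1) by (metis dist_eq_0_iff injI isometry_R3_def)
  have img: "(1 - s) *\<^sub>R A v + s *\<^sub>R A w \<in> A ` D"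
    if "closed_segment v w \<subseteq> D" "0 \<le> s" "s \<le> 1" for v w s
    using that unfolding aff[symmetric] by (auto simp: closed_segment_def)
  have pcA: "pseudoconvex (semitube ((\<lambda>p. p - q) ` A ` D))" for q
  proof -
    have "isometry_R3 (\<lambda>p. A p - q)" using A(1) by (simp add: isometry_R3_def dist_norm)
    from pc[OF this] show ?thesis by (simp add: image_image)
  qed
  have opnA: "open (A ` D)" using open_if_pseudoconvex_semitube pc[OF A(1)] by blast
  show ?thesis
  proof
    fix v assume "v \<in> closed_segment x y"
    then obtain s where s: "0 \<le> s" "s \<le> 1" and v: "v = (1 - s) *\<^sub>R x + s *\<^sub>R y"
      by (auto simp: closed_segment_def)
    have "(0, s * l) \<in> A ` D"
    proof (rule semitube_right_triangle_leg[OF pcA opnA pos])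
      fix u assume u: "0 \<le> u" "u \<le> l"
      show "(- of_real (d/l * u), u) \<in> A ` D"
        using img[OF sub(1), of "u/l"] u pos by (simp add: A scaleR_conv_of_real mult_ac)
    next
      fix t assume t: "- d \<le> t" "t \<le> 0"
      have "(1 - (1 + t/d)) *\<^sub>R A p + (1 + t/d) *\<^sub>R A y = (of_real t, l)"
        using pos by (simp add: A scaleR_conv_of_real algebra_simps)
      moreover have "0 \<le> 1 + t/d" "1 + t/d \<le> 1" using t pos by (auto simp: field_simps)
      ultimately show "(of_real t, l) \<in> A ` D" using img[OF sub(2)] by metis
    qed (use s pos in auto)
    then have "A v \<in> A ` D" using aff[of s x y] by (simp add: v A)
    then show "v \<in> D" using inj by (simp add: inj_image_mem_iff)
  qed
qed

section \<open>Convexity by a clopen argument\<close>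

lemma open_segment_endpoints:
  fixes D :: "'a::real_normed_vector set"
  assumes "open D"
  shows "open {x. closed_segment a x \<subseteq> D}"
  unfolding open_contains_ball
proof
  fix x assume "x \<in> {x. closed_segment a x \<subseteq> D}"
  then obtain e where e: "e > 0" "(\<Union>z\<in>closed_segment a x. ball z e) \<subseteq> D"
    using compact_subset_open_imp_ball_epsilon_subset[OF compact_segment assms] by blast
  have "closed_segment a y \<subseteq> D" if y: "y \<in> ball x e" for y
  proof
    fix z assume "z \<in> closed_segment a y"
    then obtain s where s: "0 \<le> s" "s \<le> 1" "z = (1 - s) *\<^sub>R a + s *\<^sub>R y"
      by (auto simp: closed_segment_def)
    define z' where "z' = (1 - s) *\<^sub>R a + s *\<^sub>R x"
    have "z' - z = s *\<^sub>R (x - y)" by (simp add: s z'_def algebra_simps)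
    then have "dist z' z = s * dist x y" using s by (simp add: dist_norm)
    also have "\<dots> \<le> 1 * dist x y" using s by (intro mult_right_mono) auto
    also have "\<dots> < e" using y by simp
    finally have "z \<in> ball z' e" by simp
    moreover have "z' \<in> closed_segment a x" using s by (auto simp: z'_def closed_segment_def)
    ultimately show "z \<in> D" using e by blast
  qed
  then show "\<exists>e>0. ball x e \<subseteq> {x. closed_segment a x \<subseteq> D}" using e by blast
qed

theorem theorem1p1:
  fixes D :: "(complex \<times> real) set"
  assumes "open D" and "connected D" and "D \<noteq> {}"
    and "\<And>A. isometry_R3 A \<Longrightarrow> pseudoconvex (semitube (A ` D))"
  shows "convex D"
proof -
  have "closed_segment a b \<subseteq> D" if ab: "a \<in> D" "b \<in> D" for a b
  proof -
    \<comment> \<open>The points visible from \<open>a\<close> inside \<open>D\<close>. This set is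
      open and relatively closed in the connected set \<open>D\<close>, hence all of it.\<close>
    define V where "V = {x. closed_segment a x \<subseteq> D}"
    have "open V" unfolding V_def by (rule open_segment_endpoints[OF assms(1)])
    have "V \<subseteq> D" unfolding V_def by auto
    then have "openin (top_of_set D) V" using \<open>open V\<close> by (simp add: open_openin_trans assms(1))
    moreover have "closedin (top_of_set D) V"
      unfolding closedin_limpt
    proof (intro conjI allI impI)
      show "V \<subseteq> D" by fact
      fix x assume x: "x islimpt V \<and> x \<in> D"
      show "x \<in> V"
      proof (cases "x = a")
        case True
        then show ?thesis using ab by (simp add: V_def)
      next
        case False
        define n where "n = x - a"
        have n: "n \<bullet> n > 0" using False by (simp add: n_def)
        obtain r where r: "r > 0" "ball x r \<subseteq> D" using x assms(1) openE by blast
        text \<open>The point of the ray from a through p whose projection to the line ax is x.\<close>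
        define f where "f p = a + ((n \<bullet> n) / ((p - a) \<bullet> n)) *\<^sub>R (p - a)" for p
        have "(f \<longlongrightarrow> a + ((n \<bullet> n) / ((x - a) \<bullet> n)) *\<^sub>R (x - a)) (at x within V)"
          unfolding f_def using n by (intro tendsto_intros) (simp add: n_def)
        then have "(f \<longlongrightarrow> x) (at x within V)"
          using n by (simp add: n_def)
        then have "\<forall>\<^sub>F p in at x within V. f p \<in> ball x r"
          using r by (simp add: tendsto_iff dist_commute)
        moreover have "\<forall>\<^sub>F p in at x within V. p \<in> ball x r"
          using r by (intro topological_tendstoD[OF tendsto_ident_at]) auto
        moreover have "((\<lambda>p. (p - a) \<bullet> n) \<longlongrightarrow> (x - a) \<bullet> n) (at x within V)"
          by (intro tendsto_intros)
        then have "\<forall>\<^sub>F p in at x within V. (p - a) \<bullet> n > 0"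
          using n by (intro order_tendstoD(1)) (auto simp: n_def)
        moreover have "\<forall>\<^sub>F p in at x within V. p \<in> V"
          by (simp add: eventually_at_filter)
        ultimately have "\<forall>\<^sub>F p in at x within V. f p \<in> ball x r \<and> p \<in> ball x r \<and> (p - a) \<bullet> n > 0 \<and> p \<in> V"
          by eventually_elim auto
        moreover have "at x within V \<noteq> bot"
          using x by (simp add: trivial_limit_within)
        ultimately obtain p where p: "f p \<in> ball x r" "p \<in> ball x r" "(p - a) \<bullet> n > 0" "p \<in> V"
          using eventually_happens' by blast
        have seg_ball: "closed_segment v w \<subseteq> D" if "v \<in> ball x r" "w \<in> ball x r" for v w
          using that r closed_segment_subset[OF _ _ convex_ball] by blast
        \<comment> \<open>The points \<open>a\<close>, \<open>p\<close>, \<open>f p\<close> lie on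
          one ray. If \<open>f p\<close> lies beyond \<open>p\<close>, the extra piece stays in the
          ball around \<open>x\<close>.\<close>
        have "closed_segment a (f p) \<subseteq> closed_segment a p \<union> closed_segment p (f p)"
        proof -
          define k where "k = (n \<bullet> n) / ((p - a) \<bullet> n)"
          have fp: "f p = a + k *\<^sub>R (p - a)" by (simp add: f_def k_def)
          have k: "k \<ge> 0" using p n by (simp add: k_def)
          show ?thesis
          proof (cases "k \<le> 1")
            case True
            then have "f p \<in> closed_segment a p"
              using k by (auto simp: fp closed_segment_def algebra_simps intro!: exI[of _ k])
            then show ?thesis by (simp add: le_supI1 subset_closed_segment)
          next
            case False
            then have "p = (1 - 1/k) *\<^sub>R a + (1/k) *\<^sub>R f p"
              by (simp add: fp algebra_simps)
            then have "p \<in> closed_segment a (f p)"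
              using False unfolding closed_segment_def
              by (intro CollectI exI[of _ "1/k"]) auto
            then show ?thesis by (simp add: Un_closed_segment)
          qed
        qed
        then have "closed_segment a (f p) \<subseteq> D"
          using p seg_ball[of p "f p"] by (auto simp: V_def)
        moreover have "closed_segment (f p) x \<subseteq> D" using seg_ball[of "f p" x] p r by simp
        \<comment> \<open>The right angle is at \<open>x\<close>: the hypotenuse runs from
          \<open>a\<close> to \<open>f p\<close>, and the leg from \<open>a\<close> to
          \<open>x\<close> is the wanted segment.\<close>
        moreover have "(f p - x) \<bullet> (x - a) = 0"
        proof -
          have "f p - x = ((n \<bullet> n) / ((p - a) \<bullet> n)) *\<^sub>R (p - a) - n"
            by (simp add: f_def n_def)
          then show ?thesis using p(3) by (simp add: inner_diff_left flip: n_def)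
        qed
        ultimately have "closed_segment a x \<subseteq> D"
          using right_triangle_segment_subset[OF assms(4)] by blast
        then show ?thesis by (simp add: V_def)
      qed
    qed
    moreover have "a \<in> V" using ab by (simp add: V_def)
    ultimately have "V = D" using assms(2) unfolding connected_clopen by blast
    then show ?thesis using ab by (auto simp: V_def)
  qed
  then show ?thesis by (simp add: convex_contains_segment)
qed

end
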